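(* Let $N\ge1$, and let $z_\alpha=x_\alpha+iy_\alpha\in\mathbb C$ and $\Gamma_\alpha\in\mathbb R$ for $\alpha=1,\dots,N$. With $q=e^{-\pi/2}$, consider the Klein bottle Hamiltonian $$\mathcal H=-\frac1{2\pi}\sum_{\alpha<\beta}\Gamma_\alpha\Gamma_\beta\log\Big|\theta_1\Big(\frac{z_\alpha-z_\beta}2,q\Big)\Big|+\frac1{2\pi}\sum_{\alpha<\beta}\Gamma_\alpha\Gamma_\beta\log\Big|\theta_2\Big(\frac{z_\alpha-\bar z_\beta}2,q\Big)\Big|-\frac1{\pi^2}\sum_{\alpha<\beta}\Gamma_\alpha\Gamma_\beta y_\alpha y_\beta$$ $$\qquad+\frac1{4\pi}\sum_\alpha\Gamma_\alpha^2\Big(\log\Big|\theta_1\Big(iy_\alpha-\frac\pi2,q\Big)\Big|-\frac{2y_\alpha^2}\pi\Big).$$ Then, wherever it is defined, $\mathcal H$ is - $\pi$-periodic vertically: invariant under $z_\alpha\mapsto z_\alpha+i\pi$ for any single $\alpha$; - $2\pi$-periodic horizontally: invariant under $z_\alpha\mapsto z_\alpha+2\pi$ for any single $\alpha$; - invariant under $\tau$: invariant under $(z_\alpha,\Gamma_\alpha)\mapsto(\bar z_\alpha+\pi,-\Gamma_\alpha)$ for any single $\alpha$.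
   Context: The Jacobi theta functions are $\theta_1(z,q)=2\sum_{n\ge0}(-1)^nq^{(n+1/2)^2}\sin((2n+1)z)$ and $\theta_2(z,q)=2\sum_{n\ge0}q^{(n+1/2)^2}\cos((2n+1)z)$. The Klein bottle is the quotient of the torus $\mathbb C/(2\pi\mathbb Z+i\pi\mathbb Z)$ by the involution $\tau(z)=\bar z+\pi$. Applying $\tau$ to a vortex also reverses the sign of its strength. *)

theory Defs
  imports "HOL-Analysis.Analysis"
begin

text \<open>The nome \<open>q\<close> is taken real and positive, so that \<open>q powr ((n + 1/2)\<^sup>2)\<close> is unambiguous.
  The series converge for \<open>0 < q < 1\<close>.\<close>

definition theta1 :: "complex \<Rightarrow> real \<Rightarrow> complex" where
  "theta1 z q =
     2 * (\<Sum>n. (-1) ^ n * of_real (q powr ((real n + 1/2)\<^sup>2)) * sin (of_nat (2 * n + 1) * z))"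

definition theta2 :: "complex \<Rightarrow> real \<Rightarrow> complex" where
  "theta2 z q =
     2 * (\<Sum>n. of_real (q powr ((real n + 1/2)\<^sup>2)) * cos (of_nat (2 * n + 1) * z))"

definition klein_nome :: real where
  "klein_nome = exp (- pi / 2)"

definition klein_tau :: "complex \<Rightarrow> complex" where
  "klein_tau z = cnj z + of_real pi"

text \<open>A configuration of \<open>N\<close> vortices is given by positions \<open>z \<alpha>\<close> and strengths \<open>\<Gamma> \<alpha>\<close> for
  \<open>\<alpha> \<in> {1..N}\<close>; values at other indices are irrelevant.\<close>

definition klein_H :: "nat \<Rightarrow> (nat \<Rightarrow> complex) \<Rightarrow> (nat \<Rightarrow> real) \<Rightarrow> real" where
  "klein_H N z \<Gamma> =
     - 1 / (2 * pi) * (\<Sum>\<beta>=1..N. \<Sum>\<alpha>=1..<\<beta>.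
         \<Gamma> \<alpha> * \<Gamma> \<beta> * ln (norm (theta1 ((z \<alpha> - z \<beta>) / 2) klein_nome)))
     + 1 / (2 * pi) * (\<Sum>\<beta>=1..N. \<Sum>\<alpha>=1..<\<beta>.
         \<Gamma> \<alpha> * \<Gamma> \<beta> * ln (norm (theta2 ((z \<alpha> - cnj (z \<beta>)) / 2) klein_nome)))
     - 1 / pi\<^sup>2 * (\<Sum>\<beta>=1..N. \<Sum>\<alpha>=1..<\<beta>.
         \<Gamma> \<alpha> * \<Gamma> \<beta> * Im (z \<alpha>) * Im (z \<beta>))
     + 1 / (4 * pi) * (\<Sum>\<alpha>=1..N.
         (\<Gamma> \<alpha>)\<^sup>2 * (ln (norm (theta1 (\<i> * of_real (Im (z \<alpha>)) - of_real pi / 2) klein_nome))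
                   - 2 * (Im (z \<alpha>))\<^sup>2 / pi))"

text \<open>In HOL \<open>ln 0 = 0\<close>, so \<open>klein_H\<close> is total. The following predicate says that
  the defining formula is meaningful, i.e. that no logarithm in it is applied to \<open>0\<close>.\<close>

definition klein_H_defined :: "nat \<Rightarrow> (nat \<Rightarrow> complex) \<Rightarrow> bool" where
  "klein_H_defined N z \<longleftrightarrow>
     (\<forall>\<beta>\<in>{1..N}. \<forall>\<alpha>\<in>{1..<\<beta>}.
        theta1 ((z \<alpha> - z \<beta>) / 2) klein_nome \<noteq> 0 \<and>
        theta2 ((z \<alpha> - cnj (z \<beta>)) / 2) klein_nome \<noteq> 0) \<and>
     (\<forall>\<alpha>\<in>{1..N}. theta1 (\<i> * of_real (Im (z \<alpha>)) - of_real pi / 2) klein_nome \<noteq> 0)"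

text \<open>Equality at a pair of configurations of the Hamiltonian regarded as a partial function:
  it is defined at both or at neither, and the values agree where defined.\<close>

definition klein_H_agree ::
  "nat \<Rightarrow> (nat \<Rightarrow> complex) \<Rightarrow> (nat \<Rightarrow> real) \<Rightarrow> (nat \<Rightarrow> complex) \<Rightarrow> (nat \<Rightarrow> real) \<Rightarrow> bool" where
  "klein_H_agree N z' \<Gamma>' z \<Gamma> \<longleftrightarrow>
     (klein_H_defined N z' \<longleftrightarrow> klein_H_defined N z) \<and>
     (klein_H_defined N z \<longrightarrow> klein_H N z' \<Gamma>' = klein_H N z \<Gamma>)"

end

theory Submission
  imports Defs
begin

text \<open>Writing \<open>\<theta>\<^sub>1 z = \<theta>\<^sub>2 (z - \<pi>/2)\<close>, everything reduces to the parity, the reality, the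
  antiperiodicity \<open>\<theta>\<^sub>2 (z + \<pi>) = -\<theta>\<^sub>2 z\<close> and the quasi-period of \<open>\<theta>\<^sub>2\<close>; for this nome the latter is
  \<open>i\<pi>/2\<close>, with \<open>|\<theta>\<^sub>2 (z + i\<pi>/2)| = exp (\<pi>/2 + 2 Im z) |\<theta>\<^sub>2 z|\<close>. Under a vertical shift the exponents
  of the two theta functions in a pair term differ by a multiple of the other vortex's height, which the
  quadratic terms compensate. The involution exchanges the two theta functions in each
  pair term, and the change of sign of the strength undoes the exchange.\<close>

section \<open>The one-sided exponential series and its shift\<close>

text \<open>With \<open>L = ln q\<close> and \<open>w = \<i> * z\<close> or
  \<open>- (\<i> * z)\<close> this is one half of the two-sided exponential series of
  \<open>theta2 z q\<close>. Keeping the index in the naturals costs a boundary term under shifts,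
  which cancels between the two halves.\<close>

definition half_theta :: "real \<Rightarrow> complex \<Rightarrow> complex" where
  "half_theta L w = (\<Sum>n. exp (of_real ((real n + 1/2)\<^sup>2 * L) + of_nat (2 * n + 1) * w))"

lemma summable_half_theta:
  fixes L :: real and w :: complex
  assumes "L < 0"
  shows "summable (\<lambda>n. exp (of_real ((real n + 1/2)\<^sup>2 * L) + of_nat (2 * n + 1) * w))"
    (is "summable ?f")
proof -
  \<comment> \<open>Consecutive terms have a ratio of norm
    \<open>exp (2 * (n + 1) * L + 2 * Re w)\<close>; from this \<open>M\<close> on it is at most
    \<open>exp (-1)\<close>.\<close>
  obtain M :: nat where M: "real M > (2 * Re w + 1) / (- 2 * L)"
    using reals_Archimedean2 by blast
  have *: "norm (?f (Suc n)) \<le> exp (-1) * norm (?f n)" if "M \<le> n" for n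
  proof -
    have "real n > (2 * Re w + 1) / (- 2 * L)"
      using M that by (meson less_le_trans of_nat_le_iff)
    then have "2 * Re w + 1 < real n * (- 2 * L)"
      by (subst (asm) pos_divide_less_eq) (use assms in simp_all)
    then have "2 * Re w + 2 * (real n + 1) * L \<le> -1"
      using assms by (simp add: algebra_simps)
    then have "(real (Suc n) + 1/2)\<^sup>2 * L + real (2 * Suc n + 1) * Re w
        \<le> -1 + ((real n + 1/2)\<^sup>2 * L + real (2 * n + 1) * Re w)"
      by (simp add: power2_eq_square algebra_simps)
    then show ?thesis
      by (simp flip: exp_add)
  qed
  show ?thesis
    by (rule summable_ratio_test[of "exp (-1)" M]) (use * in auto)
qed

text \<open>Since (n + 1/2)^2 + (2n + 1) = (n + 3/2)^2 - 1, adding \<open>L\<close> to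
  \<open>w\<close> moves the index up by one and leaves the factor \<open>exp (- L - 2 * w)\<close>.
  The subtracted exponential is that factor times the lost term for n = 0.\<close>

lemma half_theta_shift:
  assumes "L < 0"
  shows "half_theta L (w + of_real L) =
    exp (- of_real L - 2 * w) * half_theta L w - exp (- of_real (3 * L / 4) - w)"
proof -
  let ?f = "\<lambda>w n. exp (of_real ((real n + 1/2)\<^sup>2 * L) + of_nat (2 * n + 1) * w) :: complex"
  let ?c = "exp (- of_real L - 2 * w)"
  have shift: "?f (w + of_real L) n = ?c * ?f w (Suc n)" for n
    by (simp add: power2_eq_square algebra_simps flip: exp_add)
  have "half_theta L (w + of_real L) = ?c * (\<Sum>n. ?f w (Suc n))"
    unfolding half_theta_def shift
    using summable_half_theta[OF assms, of w] by (intro suminf_mult) (subst summable_Suc_iff)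
  also have "(\<Sum>n. ?f w (Suc n)) = half_theta L w - ?f w 0"
    unfolding half_theta_def by (rule suminf_split_head) (rule summable_half_theta[OF assms])
  also have "?c * (half_theta L w - ?f w 0) = ?c * half_theta L w - ?c * ?f w 0"
    by (rule right_diff_distrib)
  also have "?c * ?f w 0 = exp (- of_real (3 * L / 4) - w)"
    unfolding exp_add [symmetric]
    by (rule arg_cong[of _ _ exp]) (simp add: power2_eq_square field_simps)
  finally show ?thesis .
qed

section \<open>Quasi-period, parity, antiperiodicity and reality of the theta functions\<close>

lemma theta2_sums:
  assumes "0 < q" "q < 1"
  shows "(\<lambda>n. 2 * (of_real (q powr ((real n + 1/2)\<^sup>2)) * cos (of_nat (2 * n + 1) * z))) sums
    (half_theta (ln q) (\<i> * z) + half_theta (ln q) (- (\<i> * z)))"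
proof -
  let ?f = "\<lambda>w n. exp (of_real ((real n + 1/2)\<^sup>2 * ln q) + of_nat (2 * n + 1) * w) :: complex"
  have "(\<lambda>n. ?f w n) sums half_theta (ln q) w" for w
    unfolding half_theta_def using assms by (intro summable_sums summable_half_theta) simp
  then have "(\<lambda>n. ?f (\<i> * z) n + ?f (- (\<i> * z)) n) sums
    (half_theta (ln q) (\<i> * z) + half_theta (ln q) (- (\<i> * z)))"
    by (intro sums_add)
  moreover have "?f (\<i> * z) n + ?f (- (\<i> * z)) n =
      2 * (of_real (q powr ((real n + 1/2)\<^sup>2)) * cos (of_nat (2 * n + 1) * z))" for n
  proof -
    have "of_real (q powr ((real n + 1/2)\<^sup>2)) = (exp (of_real ((real n + 1/2)\<^sup>2 * ln q)) :: complex)"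
      using assms by (simp only: exp_of_real) (simp add: powr_def)
    moreover have "of_nat (2 * n + 1) * (\<i> * z) = \<i> * (of_nat (2 * n + 1) * z)"
      by (simp add: algebra_simps)
    ultimately show ?thesis
      by (simp only: exp_add cos_exp_eq mult_minus_right) (simp add: field_simps)
  qed
  ultimately show ?thesis by simp
qed

lemma theta2_half_theta:
  assumes "0 < q" "q < 1"
  shows "theta2 z q = half_theta (ln q) (\<i> * z) + half_theta (ln q) (- (\<i> * z))"
proof -
  have "(\<lambda>n. of_real (q powr ((real n + 1/2)\<^sup>2)) * cos (of_nat (2 * n + 1) * z)) sums
    ((half_theta (ln q) (\<i> * z) + half_theta (ln q) (- (\<i> * z))) / 2)"
    using sums_divide[OF theta2_sums[OF assms, of z], of 2] by simp
  from sums_unique[OF this, symmetric] show ?thesis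
    unfolding theta2_def by (simp only:) simp
qed

text \<open>The shift of \<open>z\<close> adds \<open>L\<close> to the argument of one half series
  and subtracts it from the other. The two boundary terms are opposite and cancel in the
  sum.\<close>

lemma theta2_quasiperiod:
  assumes "0 < q" "q < 1"
  shows "theta2 (z - \<i> * of_real (ln q)) q = exp (- of_real (ln q) - 2 * \<i> * z) * theta2 z q"
proof -
  let ?L = "of_real (ln q) :: complex" and ?A = "half_theta (ln q)"
  have L: "ln q < 0" using assms by simp
  have 1: "?A (\<i> * z + ?L) = exp (- ?L - 2 * (\<i> * z)) * ?A (\<i> * z) - exp (- of_real (3 * ln q / 4) - \<i> * z)"
    by (rule half_theta_shift[OF L])
  \<comment> \<open>The shift rule is applied at the argument already lowered by \<open>?L\<close>
    and is solved for that value below.\<close>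
  have "?A (- (\<i> * z)) = exp (?L + 2 * (\<i> * z)) * ?A (- (\<i> * z) - ?L) - exp (of_real (ln q / 4) + \<i> * z)"
    using half_theta_shift[OF L, of "- (\<i> * z) - ?L"] by (simp add: algebra_simps)
  moreover have "exp (- ?L - 2 * (\<i> * z)) * exp (?L + 2 * (\<i> * z)) = 1"
    by (simp flip: exp_add)
  moreover have "exp (- ?L - 2 * (\<i> * z)) * exp (of_real (ln q / 4) + \<i> * z) =
      exp (- of_real (3 * ln q / 4) - \<i> * z)"
    unfolding exp_add [symmetric] by (rule arg_cong[of _ _ exp]) (simp add: field_simps)
  ultimately have "exp (- ?L - 2 * (\<i> * z)) * ?A (- (\<i> * z)) =
      ?A (- (\<i> * z) - ?L) - exp (- of_real (3 * ln q / 4) - \<i> * z)"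
    by (simp only: right_diff_distrib mult_1 flip: mult.assoc)
  then have 2: "?A (- (\<i> * z) - ?L) =
      exp (- ?L - 2 * (\<i> * z)) * ?A (- (\<i> * z)) + exp (- of_real (3 * ln q / 4) - \<i> * z)"
    by simp
  have w: "\<i> * (z - \<i> * ?L) = \<i> * z + ?L" "- (\<i> * z + ?L) = - (\<i> * z) - ?L"
    by (simp_all add: algebra_simps)
  show ?thesis
    unfolding theta2_half_theta[OF assms] w 1 2 by (simp add: algebra_simps)
qed

lemma theta2_minus [simp]: "theta2 (- z) q = theta2 z q"
  by (simp add: theta2_def)

lemma theta2_plus_pi:
  assumes "0 < q" "q < 1"
  shows "theta2 (z + of_real pi) q = - theta2 z q"
proof -
  have "cos (of_nat (2 * n + 1) * (z + of_real pi)) = - cos (of_nat (2 * n + 1) * z)" for n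
  proof -
    have "of_nat (2 * n + 1) * (z + of_real pi) =
        of_nat (2 * n + 1) * z + of_real (2 * real n * pi + pi)"
      by (simp add: algebra_simps)
    moreover have "cos (of_real (2 * real n * pi + pi)) = (-1 :: complex)"
      "sin (of_real (2 * real n * pi + pi)) = (0 :: complex)"
      by (simp_all only: cos_of_real sin_of_real cos_periodic_pi sin_periodic_pi cos_2npi sin_2npi)
        simp_all
    ultimately show ?thesis by (simp only: cos_add) simp
  qed
  then have "theta2 (z + of_real pi) q =
      2 * (\<Sum>n. - (of_real (q powr ((real n + 1/2)\<^sup>2)) * cos (of_nat (2 * n + 1) * z)))"
    unfolding theta2_def by (simp only: mult_minus_right)
  moreover have "summable (\<lambda>n. of_real (q powr ((real n + 1/2)\<^sup>2)) * cos (of_nat (2 * n + 1) * z))"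
    using sums_summable[OF theta2_sums[OF assms, of z]] by simp
  ultimately show ?thesis
    unfolding theta2_def by (simp add: suminf_minus)
qed

text \<open>The coefficients of the cosine series are real, so conjugation passes to the argument in
  every term.\<close>

lemma theta2_cnj:
  assumes "0 < q" "q < 1"
  shows "theta2 (cnj z) q = cnj (theta2 z q)"
proof -
  have "(\<lambda>n. cnj (2 * (of_real (q powr ((real n + 1/2)\<^sup>2)) * cos (of_nat (2 * n + 1) * z)))) sums
      cnj (theta2 z q)"
    unfolding theta2_half_theta[OF assms] by (rule sums_cnj[THEN iffD2]) (rule theta2_sums[OF assms])
  then have "(\<lambda>n. 2 * (of_real (q powr ((real n + 1/2)\<^sup>2)) * cos (of_nat (2 * n + 1) * cnj z))) sums
      cnj (theta2 z q)"
    by (simp add: cnj_cos)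
  with theta2_sums[OF assms, of "cnj z"] show ?thesis
    unfolding theta2_half_theta[OF assms, of "cnj z"] by (rule sums_unique2)
qed

text \<open>The series agree term by term: (2n + 1) pi/2 = n pi + pi/2 has cosine 0 and sine
  (-1)^n.\<close>

lemma theta1_theta2: "theta1 z q = theta2 (z - of_real pi / 2) q"
proof -
  have "cos (of_nat (2 * n + 1) * (z - of_real pi / 2)) = (-1) ^ n * sin (of_nat (2 * n + 1) * z)" for n
  proof -
    have "of_nat (2 * n + 1) * (z - of_real pi / 2) =
        of_nat (2 * n + 1) * z - (of_real (real n * pi) + of_real (pi / 2))"
      by (simp add: field_simps)
    moreover have "cos (of_real (real n * pi) + of_real (pi / 2)) = (0 :: complex)"
      "sin (of_real (real n * pi) + of_real (pi / 2)) = ((-1) ^ n :: complex)"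
      by (simp_all only: cos_of_real sin_of_real flip: of_real_add) (simp_all add: cos_add sin_add)
    ultimately show ?thesis by (simp only: cos_diff) simp
  qed
  then show ?thesis
    unfolding theta1_def theta2_def by (simp add: ac_simps)
qed

section \<open>Absolute values at the nome of the Klein bottle\<close>

lemma klein_nome_bounds: "0 < klein_nome" "klein_nome < 1"
  by (simp_all add: klein_nome_def)

abbreviation klein_theta :: "complex \<Rightarrow> real" where
  "klein_theta z \<equiv> norm (theta2 z klein_nome)"

lemma klein_theta_cnj: "klein_theta (cnj z) = klein_theta z"
  by (simp add: theta2_cnj klein_nome_bounds)

lemma klein_theta_plus_pi: "klein_theta (z + of_real pi) = klein_theta z"
  by (simp add: theta2_plus_pi klein_nome_bounds)

text \<open>Here \<open>ln klein_nome = - pi / 2\<close>. Pair terms contain half differences of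
  positions, so raising one vortex by i pi is exactly one such step.\<close>

lemma klein_theta_quasiperiod:
  "klein_theta (z + \<i> * of_real pi / 2) = exp (pi / 2 + 2 * Im z) * klein_theta z"
proof -
  have "z + \<i> * of_real pi / 2 = z - \<i> * of_real (ln klein_nome)"
    by (simp add: klein_nome_def)
  then show ?thesis
    by (simp only: theta2_quasiperiod[OF klein_nome_bounds] norm_mult norm_exp_eq_Re)
      (simp add: klein_nome_def)
qed

lemma klein_theta_minus: "klein_theta (- z) = klein_theta z"
  by simp

section \<open>The Hamiltonian as a sum of pair and self energies\<close>

text \<open>The first factor is theta_1 of the half difference rewritten through theta_2; with a
  single function in both factors, the involution can exchange them.\<close>

definition pair_defined :: "complex \<Rightarrow> complex \<Rightarrow> bool" where
  "pair_defined a b \<longleftrightarrow>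
     klein_theta ((a - b - of_real pi) / 2) \<noteq> 0 \<and> klein_theta ((a - cnj b) / 2) \<noteq> 0"

definition pair_energy :: "complex \<Rightarrow> complex \<Rightarrow> real" where
  "pair_energy a b =
     (ln (klein_theta ((a - cnj b) / 2)) - ln (klein_theta ((a - b - of_real pi) / 2))) / (2 * pi)
     - Im a * Im b / pi\<^sup>2"

definition self_theta :: "complex \<Rightarrow> real" where
  "self_theta a = klein_theta (\<i> * of_real (Im a))"

definition self_energy :: "complex \<Rightarrow> real" where
  "self_energy a = (ln (self_theta a) - 2 * (Im a)\<^sup>2 / pi) / (4 * pi)"

lemma norm_theta1_pair:
  "norm (theta1 ((a - b) / 2) klein_nome) = klein_theta ((a - b - of_real pi) / 2)"
  by (simp add: theta1_theta2 diff_divide_distrib)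

text \<open>Passing to theta_2 subtracts a second pi/2, and the resulting full shift by pi only
  changes the sign.\<close>

lemma norm_theta1_self:
  "norm (theta1 (\<i> * of_real (Im a) - of_real pi / 2) klein_nome) = self_theta a"
  using klein_theta_plus_pi[of "\<i> * of_real (Im a) - of_real pi"]
  by (simp add: theta1_theta2 self_theta_def)

lemma klein_H_defined_iff:
  "klein_H_defined N z \<longleftrightarrow>
     (\<forall>\<beta>\<in>{1..N}. \<forall>\<alpha>\<in>{1..<\<beta>}. pair_defined (z \<alpha>) (z \<beta>)) \<and> (\<forall>\<alpha>\<in>{1..N}. self_theta (z \<alpha>) \<noteq> 0)"
  unfolding klein_H_defined_def pair_defined_def
  by (simp flip: norm_theta1_pair norm_theta1_self)

lemma klein_H_eq:
  "klein_H N z \<Gamma> =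
     (\<Sum>\<beta>=1..N. \<Sum>\<alpha>=1..<\<beta>. \<Gamma> \<alpha> * \<Gamma> \<beta> * pair_energy (z \<alpha>) (z \<beta>))
     + (\<Sum>\<alpha>=1..N. (\<Gamma> \<alpha>)\<^sup>2 * self_energy (z \<alpha>))"
proof -
  have pair: "\<Gamma> \<alpha> * \<Gamma> \<beta> * pair_energy (z \<alpha>) (z \<beta>) =
      - 1 / (2 * pi) * (\<Gamma> \<alpha> * \<Gamma> \<beta> * ln (klein_theta ((z \<alpha> - z \<beta> - of_real pi) / 2)))
      + 1 / (2 * pi) * (\<Gamma> \<alpha> * \<Gamma> \<beta> * ln (klein_theta ((z \<alpha> - cnj (z \<beta>)) / 2)))
      - 1 / pi\<^sup>2 * (\<Gamma> \<alpha> * \<Gamma> \<beta> * Im (z \<alpha>) * Im (z \<beta>))" for \<alpha> \<beta>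
    by (simp add: pair_energy_def field_simps)
  have self: "(\<Gamma> \<alpha>)\<^sup>2 * self_energy (z \<alpha>) =
      1 / (4 * pi) * ((\<Gamma> \<alpha>)\<^sup>2 * (ln (self_theta (z \<alpha>)) - 2 * (Im (z \<alpha>))\<^sup>2 / pi))" for \<alpha>
    by (simp add: self_energy_def)
  show ?thesis
    unfolding klein_H_def norm_theta1_pair norm_theta1_self pair self
    by (simp only: sum.distrib sum_subtractf flip: sum_distrib_left)
qed

text \<open>Pairs are summed with the smaller index first, so a moved vortex can stand in either
  place. Evenness reverses the difference, up to a shift by pi in the first factor and a conjugation
  in the second.\<close>

lemma pair_swap:
  "klein_theta ((b - a - of_real pi) / 2) = klein_theta ((a - b - of_real pi) / 2)"
  "klein_theta ((b - cnj a) / 2) = klein_theta ((a - cnj b) / 2)"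
proof -
  have "klein_theta ((b - a - of_real pi) / 2) = klein_theta (- ((b - a - of_real pi) / 2))"
    by simp
  also have "- ((b - a - of_real pi) / 2) = (a - b - of_real pi) / 2 + of_real pi"
    by (simp add: field_simps)
  finally show "klein_theta ((b - a - of_real pi) / 2) = klein_theta ((a - b - of_real pi) / 2)"
    by (simp only: klein_theta_plus_pi)
  have "klein_theta ((b - cnj a) / 2) = klein_theta (- cnj ((b - cnj a) / 2))"
    by (simp only: klein_theta_minus klein_theta_cnj)
  also have "- cnj ((b - cnj a) / 2) = (a - cnj b) / 2"
    by (simp add: field_simps)
  finally show "klein_theta ((b - cnj a) / 2) = klein_theta ((a - cnj b) / 2)" .
qed

lemma pair_defined_commute: "pair_defined b a \<longleftrightarrow> pair_defined a b"
  by (simp only: pair_defined_def pair_swap[of b a])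

lemma pair_energy_commute: "pair_energy b a = pair_energy a b"
  by (simp only: pair_energy_def pair_swap[of b a] mult.commute)

section \<open>Changing a single vortex\<close>

text \<open>Only terms containing vortex \<alpha> change, and by symmetry it may be taken as the
  first of its pair. The energies are compared only where the logarithms make sense, because
  \<open>ln\<close> of a product splits only for nonzero factors. The strength enters pairs linearly
  and the self term squared.\<close>

lemma klein_H_agree_upd:
  assumes dpair: "\<And>b. pair_defined w b \<longleftrightarrow> pair_defined (z \<alpha>) b"
    and dself: "self_theta w \<noteq> 0 \<longleftrightarrow> self_theta (z \<alpha>) \<noteq> 0"
    and epair: "\<And>b. pair_defined (z \<alpha>) b \<Longrightarrow> g * pair_energy w b = \<Gamma> \<alpha> * pair_energy (z \<alpha>) b"
    and eself: "self_theta (z \<alpha>) \<noteq> 0 \<Longrightarrow> g\<^sup>2 * self_energy w = (\<Gamma> \<alpha>)\<^sup>2 * self_energy (z \<alpha>)"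
  shows "klein_H_agree N (z(\<alpha> := w)) (\<Gamma>(\<alpha> := g)) z \<Gamma>"
proof -
  let ?z = "z(\<alpha> := w)" and ?G = "\<Gamma>(\<alpha> := g)"
  have dpair': "pair_defined b w \<longleftrightarrow> pair_defined b (z \<alpha>)" for b
    using dpair by (metis pair_defined_commute)
  have "pair_defined (?z \<gamma>) (?z \<beta>) \<longleftrightarrow> pair_defined (z \<gamma>) (z \<beta>)" if "\<gamma> < \<beta>" for \<gamma> \<beta>
    using that dpair dpair' by auto
  moreover have "self_theta (?z \<gamma>) \<noteq> 0 \<longleftrightarrow> self_theta (z \<gamma>) \<noteq> 0" for \<gamma>
    using dself by simp
  ultimately have "klein_H_defined N ?z \<longleftrightarrow> klein_H_defined N z"
    by (simp add: klein_H_defined_iff del: fun_upd_apply)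
  moreover have "klein_H N ?z ?G = klein_H N z \<Gamma>" if "klein_H_defined N z"
  proof -
    have "?G \<gamma> * ?G \<beta> * pair_energy (?z \<gamma>) (?z \<beta>) = \<Gamma> \<gamma> * \<Gamma> \<beta> * pair_energy (z \<gamma>) (z \<beta>)"
      if "\<beta> \<in> {1..N}" "\<gamma> \<in> {1..<\<beta>}" for \<beta> \<gamma>
    proof -
      have d: "pair_defined (z \<gamma>) (z \<beta>)"
        using that \<open>klein_H_defined N z\<close> by (auto simp: klein_H_defined_iff)
      \<comment> \<open>Since \<gamma> < \<beta>, the changed vortex occurs at most once in a
        pair.\<close>
      consider "\<gamma> = \<alpha>" "\<beta> \<noteq> \<alpha>" | "\<beta> = \<alpha>" "\<gamma> \<noteq> \<alpha>" | "\<gamma> \<noteq> \<alpha>" "\<beta> \<noteq> \<alpha>"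
        using \<open>\<gamma> \<in> {1..<\<beta>}\<close> by fastforce
      then show ?thesis
      proof cases
        case 1
        then show ?thesis using epair[of "z \<beta>"] d by (simp add: ac_simps)
      next
        case 2
        then have "g * pair_energy (z \<gamma>) w = \<Gamma> \<alpha> * pair_energy (z \<gamma>) (z \<alpha>)"
          using epair[of "z \<gamma>"] d by (simp add: pair_energy_commute pair_defined_commute)
        with 2 show ?thesis by (simp add: mult.assoc)
      next
        case 3
        then show ?thesis by simp
      qed
    qed
    moreover have "(?G \<gamma>)\<^sup>2 * self_energy (?z \<gamma>) = (\<Gamma> \<gamma>)\<^sup>2 * self_energy (z \<gamma>)"
      if "\<gamma> \<in> {1..N}" for \<gamma>
      using that eself \<open>klein_H_defined N z\<close> by (simp add: klein_H_defined_iff)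
    ultimately show ?thesis
      unfolding klein_H_eq by (intro arg_cong2[of _ _ _ _ "(+)"] sum.cong refl)
  qed
  ultimately show ?thesis
    by (simp add: klein_H_agree_def)
qed

section \<open>The three symmetries\<close>

lemma vertical_pair:
  "klein_theta ((a + \<i> * of_real pi - b - of_real pi) / 2) =
     exp (pi / 2 + Im a - Im b) * klein_theta ((a - b - of_real pi) / 2)"
  "klein_theta ((a + \<i> * of_real pi - cnj b) / 2) =
     exp (pi / 2 + Im a + Im b) * klein_theta ((a - cnj b) / 2)"
  using klein_theta_quasiperiod[of "(a - b - of_real pi) / 2"]
    klein_theta_quasiperiod[of "(a - cnj b) / 2"]
  by (simp_all add: add_divide_distrib diff_divide_distrib algebra_simps)

text \<open>The argument is not halved here, so raising the vortex by i pi takes two quasi-period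
  steps, the second starting pi/2 higher.\<close>

lemma vertical_self:
  "self_theta (a + \<i> * of_real pi) = exp (2 * pi + 4 * Im a) * self_theta a"
proof -
  let ?w = "\<i> * of_real (Im a) :: complex"
  have "\<i> * of_real (Im (a + \<i> * of_real pi)) = (?w + \<i> * of_real pi / 2) + \<i> * of_real pi / 2"
    by (simp add: algebra_simps)
  then show ?thesis
    unfolding self_theta_def
    by (simp only: klein_theta_quasiperiod) (simp add: algebra_simps flip: exp_add mult.assoc)
qed

lemma klein_H_agree_vertical:
  "klein_H_agree N (z(\<alpha> := z \<alpha> + \<i> * of_real pi)) \<Gamma> z \<Gamma>"
proof -
  \<comment> \<open>The exponents of the two factors differ by \<open>2 * Im b\<close>, which adds
    \<open>Im b / pi\<close> to the logarithmic part; the product of heights over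
    \<open>pi\<^sup>2\<close> grows by the same amount.\<close>
  have "pair_energy (a + \<i> * of_real pi) b = pair_energy a b" if "pair_defined a b" for a b
    using that unfolding pair_energy_def pair_defined_def vertical_pair
    by (simp add: ln_mult field_simps power2_eq_square)
  \<comment> \<open>The logarithm grows by \<open>2 * pi + 4 * Im a\<close>, which is also the
    growth of \<open>2 * (Im a)\<^sup>2 / pi\<close>.\<close>
  moreover have "self_energy (a + \<i> * of_real pi) = self_energy a" if "self_theta a \<noteq> 0" for a
  proof -
    have "self_theta a > 0"
      using that by (simp add: self_theta_def)
    then show ?thesis
      unfolding self_energy_def vertical_self by (simp add: ln_mult field_simps power2_eq_square)
  qed
  ultimately show ?thesis
    using klein_H_agree_upd[of "z \<alpha> + \<i> * of_real pi" z \<alpha> "\<Gamma> \<alpha>" \<Gamma> N]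
    by (simp add: pair_defined_def vertical_pair vertical_self)
qed

lemma klein_H_agree_horizontal:
  "klein_H_agree N (z(\<alpha> := z \<alpha> + 2 * of_real pi)) \<Gamma> z \<Gamma>"
proof -
  have *: "klein_theta ((a + 2 * of_real pi - b) / 2) = klein_theta ((a - b) / 2)" for a b
    using klein_theta_plus_pi[of "(a - b) / 2"]
    by (simp add: add_divide_distrib diff_divide_distrib algebra_simps)
  \<comment> \<open>The first factor has the form just treated, with \<open>b + of_real pi\<close>
    in place of \<open>b\<close>.\<close>
  have pair: "klein_theta ((a + 2 * of_real pi - b - of_real pi) / 2) =
      klein_theta ((a - b - of_real pi) / 2)" for a b
    using *[of a "b + of_real pi"] by (simp only: diff_diff_eq)
  show ?thesis
    using klein_H_agree_upd[of "z \<alpha> + 2 * of_real pi" z \<alpha> "\<Gamma> \<alpha>" \<Gamma> N]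
    unfolding pair_defined_def pair_energy_def self_theta_def self_energy_def * pair
    by simp
qed

text \<open>The pi in \<open>klein_tau\<close> cancels the pi in the first factor, leaving a
  conjugate of the second; in the second factor it gives a conjugate of the first up to a shift by
  pi.\<close>

lemma tau_pair:
  "klein_theta ((klein_tau a - b - of_real pi) / 2) = klein_theta ((a - cnj b) / 2)"
  "klein_theta ((klein_tau a - cnj b) / 2) = klein_theta ((a - b - of_real pi) / 2)"
proof -
  show "klein_theta ((klein_tau a - b - of_real pi) / 2) = klein_theta ((a - cnj b) / 2)"
    using klein_theta_cnj[of "(a - cnj b) / 2"] by (simp add: klein_tau_def)
  have "(klein_tau a - cnj b) / 2 = cnj ((a - b - of_real pi) / 2) + of_real pi"
    by (simp add: klein_tau_def field_simps)
  then show "klein_theta ((klein_tau a - cnj b) / 2) = klein_theta ((a - b - of_real pi) / 2)"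
    by (simp only: klein_theta_plus_pi klein_theta_cnj)
qed

lemma klein_H_agree_tau:
  "klein_H_agree N (z(\<alpha> := klein_tau (z \<alpha>))) (\<Gamma>(\<alpha> := - \<Gamma> \<alpha>)) z \<Gamma>"
proof (rule klein_H_agree_upd)
  have im: "Im (klein_tau a) = - Im a" for a
    by (simp add: klein_tau_def)
  \<comment> \<open>Evenness of theta_2 absorbs the reflected height.\<close>
  have self: "self_theta (klein_tau a) = self_theta a" for a
    by (simp add: self_theta_def im)
  show "pair_defined (klein_tau (z \<alpha>)) b \<longleftrightarrow> pair_defined (z \<alpha>) b" for b
    unfolding pair_defined_def tau_pair by blast
  show "self_theta (klein_tau (z \<alpha>)) \<noteq> 0 \<longleftrightarrow> self_theta (z \<alpha>) \<noteq> 0"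
    by (simp add: self)
  \<comment> \<open>The exchange of factors negates the difference of logarithms and the reflection
    negates the product of heights, so the pair energy changes sign together with the
    strength.\<close>
  show "- \<Gamma> \<alpha> * pair_energy (klein_tau (z \<alpha>)) b = \<Gamma> \<alpha> * pair_energy (z \<alpha>) b" for b
    unfolding pair_energy_def tau_pair im by (simp add: field_simps)
  show "(- \<Gamma> \<alpha>)\<^sup>2 * self_energy (klein_tau (z \<alpha>)) = (\<Gamma> \<alpha>)\<^sup>2 * self_energy (z \<alpha>)"
    by (simp add: self_energy_def self im)
qed

theorem lemma5p6:
  fixes N :: nat and z :: "nat \<Rightarrow> complex" and \<Gamma> :: "nat \<Rightarrow> real"
  assumes "N \<ge> 1"
  shows "(\<forall>\<alpha>\<in>{1..N}. klein_H_agree N (z(\<alpha> := z \<alpha> + \<i> * of_real pi)) \<Gamma> z \<Gamma>) \<and>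
         (\<forall>\<alpha>\<in>{1..N}. klein_H_agree N (z(\<alpha> := z \<alpha> + 2 * of_real pi)) \<Gamma> z \<Gamma>) \<and>
         (\<forall>\<alpha>\<in>{1..N}. klein_H_agree N (z(\<alpha> := klein_tau (z \<alpha>))) (\<Gamma>(\<alpha> := - \<Gamma> \<alpha>)) z \<Gamma>)"
  using klein_H_agree_vertical klein_H_agree_horizontal klein_H_agree_tau by blast

end
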